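(* Let $q$ be a prime power, let $m,n\ge 1$, and let $\mathcal{C}$ be an $[n,k,d]_{q^m/q}$ code. If $\mathcal{C}$ is rank-metric intersecting, then $n\ge 2k-1$.
   Context: Support and rank: fix an $\mathbb{F}_q$-basis $\Gamma$ of $\mathbb{F}_{q^m}$. For $x=(x_1,\dots,x_n)\in\mathbb{F}_{q^m}^n$ let $\mathrm{Mat}_\Gamma(x)\in\mathbb{F}_q^{m\times n}$ be the matrix whose $j$-th column is the coordinate vector of $x_j$ in the basis $\Gamma$. The support $\sigma(x)\subseteq\mathbb{F}_q^n$ is the $\mathbb{F}_q$-row space of $\mathrm{Mat}_\Gamma(x)$, and $\mathrm{rk}(x)=\dim_{\mathbb{F}_q}\sigma(x)$; both are independent of $\Gamma$. An $[n,k,d]_{q^m/q}$ code is an $\mathbb{F}_{q^m}$-linear subspace $\mathcal{C}$ of $\mathbb{F}_{q^m}^n$ with $k=\dim_{\mathbb{F}_{q^m}}\mathcal{C}\ge 1$ and minimum distance $d=\min_{c\in\mathcal{C}\setminus\{0\}}\mathrm{rk}(c)$. The code is rank-metric intersecting if $\sigma(c)\cap\sigma(c')\ne\{0\}$ for all $c,c'\in\mathcal{C}\setminus\{0\}$. *)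

theory Defs
  imports "HOL-Analysis.Cartesian_Space"
begin

text \<open>
  A field extension is given by an embedding \<open>\<iota>\<close> of the base field \<open>'fq\<close> into \<open>'fqm\<close>.
  Vectors of length \<open>n\<close> are indexed by a finite type with \<open>n\<close> elements.
\<close>

locale field_extension =
  fixes \<iota> :: "'fq::field \<Rightarrow> 'fqm::field"
  assumes hom_add: "\<iota> (a + b) = \<iota> a + \<iota> b"
    and hom_mult: "\<iota> (a * b) = \<iota> a * \<iota> b"
    and hom_one: "\<iota> 1 = 1"

sublocale field_extension \<subseteq> ext: vector_space "\<lambda>a x. \<iota> a * x"
  by unfold_locales (simp_all add: hom_add hom_mult hom_one algebra_simps)

text \<open>
  \<open>\<Gamma>\<close> is an ordered basis of \<open>'fqm\<close> over \<open>'fq\<close>, so that the degree of the extension is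
  \<open>CARD('m)\<close>.
\<close>

locale field_extension_basis = field_extension \<iota>
  for \<iota> :: "'fq::{field,finite} \<Rightarrow> 'fqm::{field,finite}" +
  fixes \<Gamma> :: "'m::finite \<Rightarrow> 'fqm"
  assumes basis_inj: "inj \<Gamma>"
    and basis_independent: "ext.independent (range \<Gamma>)"
    and basis_span: "ext.span (range \<Gamma>) = UNIV"
begin

definition Mat :: "'fqm ^ 'n \<Rightarrow> 'fq ^ 'n ^ 'm" where
  "Mat x = (\<chi> i j. ext.representation (range \<Gamma>) (x $ j) (\<Gamma> i))"

definition support :: "'fqm ^ 'n \<Rightarrow> ('fq ^ 'n) set" where
  "support x = vec.span (rows (Mat x))"

definition rk :: "'fqm ^ 'n \<Rightarrow> nat" where
  "rk x = vec.dim (support x)"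

definition min_distance :: "('fqm ^ 'n) set \<Rightarrow> nat" where
  "min_distance C = Min (rk ` (C - {0}))"

definition is_code :: "('fqm ^ 'n) set \<Rightarrow> nat \<Rightarrow> nat \<Rightarrow> bool" where
  "is_code C k d \<longleftrightarrow>
     vec.subspace C \<and> vec.dim C = k \<and> k \<ge> 1 \<and> min_distance C = d"

definition rank_metric_intersecting :: "('fqm ^ 'n) set \<Rightarrow> bool" where
  "rank_metric_intersecting C \<longleftrightarrow>
     (\<forall>c \<in> C - {0}. \<forall>c' \<in> C - {0}. support c \<inter> support c' \<noteq> {0})"

end

end

theory Submission
  imports Defs
begin

text \<open>
  If \<open>n \<le> 2k - 2\<close>, the coordinates split into two parts of fewer than \<open>k\<close> elements each. By
  dimension, \<open>C\<close> contains a nonzero word vanishing on the first part and one vanishing on the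
  second. Their supports live on complementary sets of coordinates, so they meet in \<open>0\<close>.
\<close>

text \<open>Restriction to the coordinates in \<open>I\<close> has rank at most
  \<open>card I\<close>, so it cannot be injective on \<open>C\<close>. Two distinct words with the
  same restriction differ by the required word.\<close>

lemma exists_nonzero_vanishing_on:
  fixes C :: "('a::field ^ 'n) set"
  assumes C: "vec.subspace C" and I: "card I < vec.dim C"
  obtains c where "c \<in> C" "c \<noteq> 0" "\<And>i. i \<in> I \<Longrightarrow> c $ i = 0"
proof -
  \<comment> \<open>The restriction is padded with zeros outside \<open>I\<close>: a set cannot
    index a vector type, and the image then lies in the span of the unit vectors at
    \<open>I\<close>.\<close>
  define f :: "'a ^ 'n \<Rightarrow> 'a ^ 'n" where "f x = (\<chi> i. if i \<in> I then x $ i else 0)" for x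
  have lin: "Vector_Spaces.linear (*s) (*s) f"
    by unfold_locales (auto simp: f_def vec_eq_iff algebra_simps)
  have "x \<in> vec.span ((\<lambda>i. axis i 1) ` I)" if "x \<in> f ` C" for x
  proof -
    have "x = (\<Sum>i\<in>UNIV. x $ i *s axis i 1)"
      by (simp add: basis_expansion)
    also have "\<dots> = (\<Sum>i\<in>I. x $ i *s axis i 1)"
      using that by (intro sum.mono_neutral_right) (auto simp: f_def)
    also have "\<dots> \<in> vec.span ((\<lambda>i. axis i 1) ` I)"
      by (auto intro!: vec.span_sum vec.span_scale intro: vec.span_base)
    finally show ?thesis .
  qed
  then have "vec.dim (f ` C) \<le> card ((\<lambda>i. axis i 1 :: 'a ^ 'n) ` I)"
    by (intro vec.dim_le_card) auto
  also have "\<dots> \<le> card I"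
    by (simp add: card_image_le)
  finally have "vec.dim (f ` C) \<noteq> vec.dim C"
    using I by linarith
  \<comment> \<open>\<open>vec.dim_image_eq\<close> asks for injectivity on the span, which here is
    \<open>C\<close> itself.\<close>
  moreover have "vec.span C = C"
    using C by (simp add: vec.span_eq_iff)
  ultimately have "\<not> inj_on f C"
    using vec.dim_image_eq[OF lin, of C] by metis
  then obtain x y where xy: "x \<in> C" "y \<in> C" "x \<noteq> y" "f x = f y"
    by (auto simp: inj_on_def)
  then have "(x - y) $ i = 0" if "i \<in> I" for i
    using that by (auto simp: f_def vec_eq_iff split: if_splits)
  then show thesis
    using xy C by (intro that[of "x - y"]) (auto intro: vec.subspace_diff)
qed

context field_extension_basis
begin

text \<open>Column \<open>j\<close> of \<open>Mat c\<close> holds the coordinates of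
  \<open>c $ j\<close>. If that entry is 0, every row is 0 at \<open>j\<close>, and so is every
  combination of rows.\<close>

lemma support_vanishing_on:
  fixes c :: "'fqm ^ 'n"
  assumes "c $ j = 0" and "s \<in> support c"
  shows "s $ j = 0"
  using assms(2) unfolding support_def
proof (induction rule: vec.span_induct_alt)
  case (step a r s)
  then show ?case
    using assms(1) by (auto simp: rows_def row_def Mat_def ext.representation_zero)
qed simp

lemma code_dim_bound:
  fixes C :: "('fqm ^ 'n) set"
  assumes C: "vec.subspace C" and inter: "rank_metric_intersecting C" and dim: "vec.dim C \<ge> 1"
  shows "2 * vec.dim C \<le> CARD('n) + 1"
proof (rule ccontr)
  assume large: "\<not> ?thesis"
  have "vec.dim C - 1 \<le> CARD('n)"
    using vec.dim_subset_UNIV[of C] by (simp add: vec.dimension_def card_cart_basis)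
  then obtain I :: "'n set" where I: "card I = vec.dim C - 1"
    by (metis obtain_subset_with_card_n)
  have "card I < vec.dim C"
    using I dim by simp
  then obtain c where c: "c \<in> C" "c \<noteq> 0" "\<And>i. i \<in> I \<Longrightarrow> c $ i = 0"
    using exists_nonzero_vanishing_on[OF C] by blast
  \<comment> \<open>With k the dimension and n the length, the complement has n - (k - 1) elements,
    and the negated bound n + 1 < 2k puts this below k.\<close>
  have "card (- I) < vec.dim C"
    using I dim large by (simp add: Compl_eq_Diff_UNIV card_Diff_subset)
  then obtain c' where c': "c' \<in> C" "c' \<noteq> 0" "\<And>i. i \<in> - I \<Longrightarrow> c' $ i = 0"
    using exists_nonzero_vanishing_on[OF C] by blast
  have "s = 0" if "s \<in> support c \<inter> support c'" for s
  proof -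
    \<comment> \<open>Either \<open>c\<close> or \<open>c'\<close> vanishes at \<open>i\<close>,
      according to whether \<open>i\<close> lies in \<open>I\<close>, and \<open>s\<close> is in
      both supports.\<close>
    have "s $ i = 0" for i
      using that c(3)[of i] c'(3)[of i] support_vanishing_on[of _ i s] by blast
    then show ?thesis
      by (simp add: vec_eq_iff)
  qed
  moreover have "0 \<in> support c \<inter> support c'"
    by (simp add: support_def vec.span_zero)
  ultimately have "support c \<inter> support c' = {0}"
    by blast
  then show False
    using inter c c' unfolding rank_metric_intersecting_def by blast
qed

end

theorem corollary2p4:
  fixes \<iota> :: "'fq::{field,finite} \<Rightarrow> 'fqm::{field,finite}"
    and \<Gamma> :: "'m::finite \<Rightarrow> 'fqm"
    and C :: "('fqm ^ 'n::finite) set"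
    and q m n k d :: nat
  assumes "CARD('fq) = q" and "CARD('fqm) = q ^ m" and "CARD('n) = n"
    and "field_extension_basis \<iota> \<Gamma>"
    and "field_extension_basis.is_code \<iota> \<Gamma> C k d"
    and "field_extension_basis.rank_metric_intersecting \<iota> \<Gamma> C"
  shows "int n \<ge> 2 * int k - 1"
proof -
  interpret field_extension_basis \<iota> \<Gamma> by fact
  have "2 * k \<le> n + 1"
    using assms(3,5,6) code_dim_bound[of C] by (auto simp: is_code_def)
  then show ?thesis by linarith
qed

end
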